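(* Let $G$ be a finite simple graph. Then $G$ has an optimal semi-proper orientation $(D,w)$ such that $w(e)\in\{1,2\}$ for every edge $e\in E(G)$.
   Context: All graphs are finite, simple and undirected. An orientation $D$ of $G$ replaces each edge $uv$ by exactly one of the arcs $u\to v$ or $v\to u$. A semi-proper orientation of $G$ is a pair $(D,w)$ where $D$ is an orientation of $G$ and $w:E(G)\to\mathbb{Z}_{>0}$ is a positive integer weight function, such that for every two adjacent vertices $u,v$ we have $S_{(D,w)}(u)\neq S_{(D,w)}(v)$, where $S_{(D,w)}(v)=\sum_{z\in N^-_D(v)} w(zv)$ is the sum of the weights of the edges whose head is $v$ in $D$. The semi-proper orientation number is $\overrightarrow{\chi}_s(G)=\min_{(D,w)\in\Gamma}\max_{v\in V(G)} S_{(D,w)}(v)$, where $\Gamma$ is the set of all semi-proper orientations of $G$. An optimal semi-proper orientation is a semi-proper orientation $(D,w)$ with $\max_{v\in V(G)} S_{(D,w)}(v)=\overrightarrow{\chi}_s(G)$. *)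

theory Defs
  imports Main
begin

definition simple_graph :: "'a set \<Rightarrow> 'a set set \<Rightarrow> bool" where
  "simple_graph V E \<longleftrightarrow> finite V \<and> (\<forall>e\<in>E. e \<subseteq> V \<and> card e = 2)"

text \<open>The pair \<open>(u, v)\<close> encodes the arc from \<open>u\<close> to \<open>v\<close>.\<close>

definition is_orientation :: "'a set set \<Rightarrow> ('a \<times> 'a) set \<Rightarrow> bool" where
  "is_orientation E D \<longleftrightarrow>
     (\<forall>u v. (u, v) \<in> D \<longrightarrow> {u, v} \<in> E) \<and>
     (\<forall>u v. {u, v} \<in> E \<longrightarrow> ((u, v) \<in> D \<and> (v, u) \<notin> D) \<or> ((u, v) \<notin> D \<and> (v, u) \<in> D))"

definition in_neighbours :: "('a \<times> 'a) set \<Rightarrow> 'a \<Rightarrow> 'a set" where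
  "in_neighbours D v = {z. (z, v) \<in> D}"

definition in_weight :: "('a \<times> 'a) set \<Rightarrow> ('a set \<Rightarrow> nat) \<Rightarrow> 'a \<Rightarrow> nat" where
  "in_weight D w v = (\<Sum>z\<in>in_neighbours D v. w {z, v})"

text \<open>Weight functions are total on sets of vertices; only their values on \<open>E\<close> matter.\<close>

definition semi_proper_orientations ::
    "'a set set \<Rightarrow> (('a \<times> 'a) set \<times> ('a set \<Rightarrow> nat)) set" where
  "semi_proper_orientations E =
     {(D, w). is_orientation E D \<and> (\<forall>e\<in>E. w e > 0) \<and>
              (\<forall>u v. {u, v} \<in> E \<longrightarrow> in_weight D w u \<noteq> in_weight D w v)}"

text \<open>On \<open>nat\<close>, \<open>Sup\<close> of a finite nonempty set is its maximum, and \<open>Sup {} = 0\<close>, so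
  the graph without vertices has maximum \<open>0\<close>; \<open>Inf\<close> of a nonempty set is its minimum.\<close>

definition max_in_weight :: "'a set \<Rightarrow> ('a \<times> 'a) set \<Rightarrow> ('a set \<Rightarrow> nat) \<Rightarrow> nat" where
  "max_in_weight V D w = (SUP v\<in>V. in_weight D w v)"

definition semi_proper_orientation_number :: "'a set \<Rightarrow> 'a set set \<Rightarrow> nat" where
  "semi_proper_orientation_number V E =
     (INF (D, w)\<in>semi_proper_orientations E. max_in_weight V D w)"

definition optimal_semi_proper_orientation ::
    "'a set \<Rightarrow> 'a set set \<Rightarrow> ('a \<times> 'a) set \<Rightarrow> ('a set \<Rightarrow> nat) \<Rightarrow> bool" where
  "optimal_semi_proper_orientation V E D w \<longleftrightarrow>
     (D, w) \<in> semi_proper_orientations E \<and>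
     max_in_weight V D w = semi_proper_orientation_number V E"

end

theory Submission
  imports Defs
begin

text \<open>Replace the weights by the in-weights they produce: a vertex labelling \<open>S\<close> comes from positive
  weights on \<open>D\<close> iff \<open>S v\<close> is at least the in-degree \<open>d v\<close>, with \<open>S v = 0\<close> where \<open>d v = 0\<close>, and it
  comes from weights in \<open>{1, 2}\<close> iff moreover \<open>S v \<le> 2 * d v\<close>. Among the pairs \<open>(D, S)\<close> with
  \<open>S \<le> k\<close>, minimise first \<open>\<Sum>v. S v\<close> and then \<open>\<Sum>v. d v * (k - S v)\<close>. Suppose \<open>S v > 2 * d v\<close>.
  Then some \<open>j\<close> with \<open>d v \<le> j < S v\<close> is not the label of an in-neighbour of \<open>v\<close>. If no
  out-neighbour has label \<open>j\<close> either, relabel \<open>v\<close> by \<open>j\<close>. Otherwise reverse an arc from \<open>v\<close> to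
  such an out-neighbour \<open>u\<close>, and if \<open>v\<close> was the only in-neighbour of \<open>u\<close>, also relabel \<open>u\<close> by \<open>0\<close>;
  this is proper because all other neighbours of \<open>u\<close> are heads of arcs. Each move contradicts
  minimality.\<close>

section \<open>In-degrees, labellings and arc reversal\<close>

definition in_degree :: "('a \<times> 'a) set \<Rightarrow> 'a \<Rightarrow> nat" where
  "in_degree D v = card (in_neighbours D v)"

text \<open>The bounds range over the whole type: in a graph on \<open>V\<close>, vertices outside
  \<open>V\<close> have in-degree 0 and so are forced to label 0.\<close>

definition proper_labelling ::
    "'a set set \<Rightarrow> nat \<Rightarrow> ('a \<times> 'a) set \<Rightarrow> ('a \<Rightarrow> nat) \<Rightarrow> bool" where
  "proper_labelling E k D S \<longleftrightarrow>
     is_orientation E D \<and>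
     (\<forall>v. in_degree D v \<le> S v \<and> S v \<le> k \<and> (in_degree D v = 0 \<longrightarrow> S v = 0)) \<and>
     (\<forall>u v. {u, v} \<in> E \<longrightarrow> S u \<noteq> S v)"

definition reverse_arc :: "('a \<times> 'a) set \<Rightarrow> 'a \<Rightarrow> 'a \<Rightarrow> ('a \<times> 'a) set" where
  "reverse_arc D v u = insert (u, v) (D - {(v, u)})"

lemma simple_graph_edgeD:
  assumes "simple_graph V E" "{u, v} \<in> E"
  shows "u \<noteq> v" "u \<in> V" "v \<in> V"
  using assms unfolding simple_graph_def by force+

lemma in_neighbours_subset:
  assumes "simple_graph V E" "is_orientation E D"
  shows "in_neighbours D v \<subseteq> V"
  using assms simple_graph_edgeD(2)[OF assms(1)]
  unfolding is_orientation_def in_neighbours_def by blast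

lemma finite_in_neighbours:
  assumes "simple_graph V E" "is_orientation E D"
  shows "finite (in_neighbours D v)"
  using in_neighbours_subset[OF assms] assms(1) unfolding simple_graph_def
  by (meson finite_subset)

lemma is_orientation_reverse_arc:
  assumes "is_orientation E D" "(v, u) \<in> D" "u \<noteq> v"
  shows "is_orientation E (reverse_arc D v u)"
proof -
  have "{u, v} \<in> E" "(u, v) \<notin> D"
    using assms unfolding is_orientation_def by (metis insert_commute)+
  then show ?thesis
    using assms unfolding is_orientation_def reverse_arc_def by (auto simp: insert_commute)
qed

lemma in_neighbours_reverse_arc:
  assumes "u \<noteq> v"
  shows "in_neighbours (reverse_arc D v u) x =
    (if x = v then insert u (in_neighbours D v)
     else if x = u then in_neighbours D u - {v} else in_neighbours D x)"
  using assms unfolding in_neighbours_def reverse_arc_def by auto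

lemma in_degree_reverse_arc:
  assumes "simple_graph V E" "is_orientation E D" "(v, u) \<in> D" "u \<noteq> v"
  shows "in_degree (reverse_arc D v u) x =
    (if x = v then in_degree D v + 1
     else if x = u then in_degree D u - 1 else in_degree D x)"
proof -
  have "(u, v) \<notin> D"
    using assms unfolding is_orientation_def by (metis insert_commute)
  then have "u \<notin> in_neighbours D v" "v \<in> in_neighbours D u"
    using assms(3) unfolding in_neighbours_def by auto
  then show ?thesis
    using assms(4) finite_in_neighbours[OF assms(1,2)]
    by (auto simp: in_degree_def in_neighbours_reverse_arc)
qed

section \<open>Descent on labellings\<close>

lemma sum_fun_upd_less:
  fixes S :: "'a \<Rightarrow> nat"
  assumes "finite V" "v \<in> V" "j < S v"
  shows "sum (S(v := j)) V < sum S V"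
  using assms by (intro sum_strict_mono_ex1) auto

text \<open>Reversal moves one unit of in-degree from \<open>u\<close> to \<open>v\<close>, where
  the factor \<open>k - S\<close> is smaller; \<open>S v \<le> k\<close> keeps the truncated
  subtraction exact.\<close>

lemma sum_reverse_arc_less:
  fixes S :: "'a \<Rightarrow> nat"
  assumes G: "simple_graph V E" and D: "is_orientation E D"
    and vu: "(v, u) \<in> D" and less: "S u < S v" "S v \<le> k"
  shows "(\<Sum>x\<in>V. in_degree (reverse_arc D v u) x * (k - S x)) < (\<Sum>x\<in>V. in_degree D x * (k - S x))"
proof -
  let ?d = "in_degree D" and ?d' = "in_degree (reverse_arc D v u)"
  have E: "{v, u} \<in> E" using D vu unfolding is_orientation_def by blast
  note uv = simple_graph_edgeD[OF G E]
  have fin: "finite V" using G unfolding simple_graph_def by simp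
  have split: "(\<Sum>x\<in>V. f x) = f u + (f v + (\<Sum>x\<in>V - {u} - {v}. f x))" for f :: "'a \<Rightarrow> nat"
    using fin uv by (simp add: sum.remove[of V u] sum.remove[of "V - {u}" v])
  have d': "?d' x = (if x = v then ?d v + 1 else if x = u then ?d u - 1 else ?d x)" for x
    using in_degree_reverse_arc[OF G D vu] uv by auto
  have rest: "(\<Sum>x\<in>V - {u} - {v}. ?d' x * (k - S x)) = (\<Sum>x\<in>V - {u} - {v}. ?d x * (k - S x))"
    by (intro sum.cong) (auto simp: d')
  \<comment> \<open>Positivity of \<open>?d u\<close> makes the truncated \<open>?d u - 1\<close>
    lose exactly one unit.\<close>
  have "v \<in> in_neighbours D u" using vu unfolding in_neighbours_def by simp
  then have "?d u > 0"
    using finite_in_neighbours[OF G D, of u] unfolding in_degree_def by (auto simp: card_gt_0_iff)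
  then obtain m where m: "?d u = Suc m" by (cases "?d u") auto
  have "k - S v < k - S u" using less by simp
  then have "?d' u * (k - S u) + ?d' v * (k - S v) < ?d u * (k - S u) + ?d v * (k - S v)"
    using uv m by (simp add: d')
  then show ?thesis
    unfolding split[of "\<lambda>x. ?d' x * (k - S x)"] split[of "\<lambda>x. ?d x * (k - S x)"] rest by linarith
qed

text \<open>The order is lexicographic: both relabelling moves lower the sum of labels, while a bare
  reversal keeps it and lowers the second sum.\<close>

lemma proper_labelling_improve:
  assumes G: "simple_graph V E" and P: "proper_labelling E k D S"
    and big: "2 * in_degree D v < S v"
  obtains D' S' where "proper_labelling E k D' S'"
    "((D', S'), (D, S)) \<in> measures [\<lambda>(D, S). sum S V, \<lambda>(D, S). \<Sum>x\<in>V. in_degree D x * (k - S x)]"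
proof -
  let ?d = "in_degree D"
  have D: "is_orientation E D" and lo: "\<And>x. ?d x \<le> S x" and hi: "\<And>x. S x \<le> k"
    and zero: "\<And>x. ?d x = 0 \<Longrightarrow> S x = 0" and ne: "\<And>x y. {x, y} \<in> E \<Longrightarrow> S x \<noteq> S y"
    using P unfolding proper_labelling_def by blast+
  note finN = finite_in_neighbours[OF G D]
  have fin: "finite V" using G unfolding simple_graph_def by simp
  have dv: "?d v > 0" using big zero[of v] by (cases "?d v") auto
  have dpos: "?d x > 0" if "(y, x) \<in> D" for x y
    using that finN[of x] unfolding in_degree_def in_neighbours_def by (auto simp: card_gt_0_iff)
  have vV: "v \<in> V"
  proof -
    obtain z where "(z, v) \<in> D"
      using dv unfolding in_degree_def in_neighbours_def by (auto simp: card_gt_0_iff)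
    then have "{z, v} \<in> E" using D unfolding is_orientation_def by blast
    then show ?thesis using simple_graph_edgeD(3)[OF G] by blast
  qed
  \<comment> \<open>Pigeonhole: by \<open>big\<close> the interval has more than \<open>?d v\<close>
    elements, while the in-neighbours carry at most \<open>?d v\<close> labels.\<close>
  have "card (S ` in_neighbours D v) < card {?d v..<S v}"
    using card_image_le[OF finN, of S v] big unfolding in_degree_def by simp
  then obtain j where j: "?d v \<le> j" "j < S v" "j \<notin> S ` in_neighbours D v"
    using card_mono[of "S ` in_neighbours D v" "{?d v..<S v}"] finN by fastforce
  show ?thesis
  proof (cases "\<exists>u. {u, v} \<in> E \<and> S u = j")
    case False
    have "proper_labelling E k D (S(v := j))"
      unfolding proper_labelling_def
    proof (intro conjI allI impI)
      show "is_orientation E D" by (fact D)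
      show "?d x \<le> (S(v := j)) x" for x using lo j by simp
      show "(S(v := j)) x \<le> k" for x using hi[of x] j by auto
      show "(S(v := j)) x = 0" if "?d x = 0" for x using that zero dv by auto
      show "(S(v := j)) x \<noteq> (S(v := j)) y" if "{x, y} \<in> E" for x y
        using that ne[OF that] False simple_graph_edgeD(1)[OF G that]
        by (auto simp: insert_commute)
    qed
    then show ?thesis
      using that sum_fun_upd_less[OF fin vV, of j S] j(2) by simp
  next
    case True
    then obtain u where u: "{u, v} \<in> E" "S u = j" by blast
    note uv = simple_graph_edgeD[OF G u(1)]
    \<comment> \<open>No in-neighbour of \<open>v\<close> has label \<open>j\<close>, so this edge
      must leave \<open>v\<close>.\<close>
    have vu: "(v, u) \<in> D"
      using u j(3) D unfolding is_orientation_def in_neighbours_def by blast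
    let ?D = "reverse_arc D v u"
    have D': "is_orientation E ?D" using is_orientation_reverse_arc[OF D vu] uv by blast
    have d': "in_degree ?D x = (if x = v then ?d v + 1 else if x = u then ?d u - 1 else ?d x)" for x
      using in_degree_reverse_arc[OF G D vu] uv by auto
    \<comment> \<open>At \<open>v\<close> the larger in-degree still fits, since
      \<open>?d v + 1 \<le> 2 * ?d v < S v\<close>.\<close>
    have lo': "in_degree ?D x \<le> S x" for x
      using lo[of x] big dv by (auto simp: d')
    show ?thesis
    proof (cases "?d u = 1")
      case False
      then have "proper_labelling E k ?D S"
        using D' lo' hi zero ne dpos[OF vu] unfolding proper_labelling_def by (auto simp: d')
      then show ?thesis
        using that sum_reverse_arc_less[OF G D vu, of S k] u j hi by simp
    next
      case True
      have only: "x = v" if "(x, u) \<in> D" for x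
        using True that vu unfolding in_degree_def in_neighbours_def
        by (metis card_1_singletonE mem_Collect_eq singletonD)
      \<comment> \<open>A neighbour with an arc into \<open>u\<close> is \<open>v\<close>, whose
        label is positive by \<open>big\<close>; any other is the head of an arc from
        \<open>u\<close>.\<close>
      have nz: "S x \<noteq> 0" if "{x, u} \<in> E" for x
      proof (cases "(x, u) \<in> D")
        case True
        then show ?thesis using only big by fastforce
      next
        case False
        then have "(u, x) \<in> D" using D that unfolding is_orientation_def by blast
        then show ?thesis using dpos lo[of x] by fastforce
      qed
      have "proper_labelling E k ?D (S(u := 0))"
        unfolding proper_labelling_def
      proof (intro conjI allI impI)
        show "is_orientation E ?D" by (fact D')
        show "in_degree ?D x \<le> (S(u := 0)) x" for x
          using lo'[of x] True uv by (auto simp: d')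
        show "(S(u := 0)) x \<le> k" for x using hi by auto
        show "(S(u := 0)) x = 0" if "in_degree ?D x = 0" for x
          using that zero[of x] by (auto simp: d' split: if_splits)
        show "(S(u := 0)) x \<noteq> (S(u := 0)) y" if "{x, y} \<in> E" for x y
          using that ne[OF that] nz[of x] nz[of y] simple_graph_edgeD(1)[OF G that]
          by (auto simp: insert_commute)
      qed
      \<comment> \<open>As \<open>j \<ge> ?d v > 0\<close>, resetting \<open>u\<close> to 0 strictly
        lowers the sum of labels.\<close>
      moreover have "0 < S u" using u j dv by simp
      ultimately show ?thesis
        using that sum_fun_upd_less[OF fin uv(2), of 0 S] by simp
    qed
  qed
qed

lemma exists_balanced_proper_labelling:
  assumes G: "simple_graph V E" and "proper_labelling E k D0 S0"
  obtains D S where "proper_labelling E k D S" "\<And>v. S v \<le> 2 * in_degree D v"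
proof -
  let ?R = "measures [\<lambda>(D, S). sum S V, \<lambda>(D, S). \<Sum>x\<in>V. in_degree D x * (k - S x)]"
  let ?Q = "{(D, S). proper_labelling E k D S}"
  have "(D0, S0) \<in> ?Q" using assms by simp
  from wfE_min[OF wf_measures this] obtain p where "p \<in> ?Q" "\<And>q. (q, p) \<in> ?R \<Longrightarrow> q \<notin> ?Q"
    by blast
  then obtain D S where DS: "proper_labelling E k D S"
    and min: "\<And>q. (q, (D, S)) \<in> ?R \<Longrightarrow> q \<notin> ?Q" by (cases p) auto
  have "S v \<le> 2 * in_degree D v" for v
  proof (rule ccontr)
    assume "\<not> ?thesis"
    then have "2 * in_degree D v < S v" by simp
    from proper_labelling_improve[OF G DS this] obtain D' S'
      where "proper_labelling E k D' S'" "((D', S'), (D, S)) \<in> ?R" .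
    with min show False by blast
  qed
  then show ?thesis using DS that by blast
qed

section \<open>Passing between labellings and weights\<close>

text \<open>Weight 2 on \<open>S v - in_degree D v\<close> of the edges into \<open>v\<close> and 1
  on the others gives \<open>S v\<close>; every edge has a single head, so these choices are
  independent.\<close>

lemma exists_weights_one_two:
  assumes G: "simple_graph V E" and D: "is_orientation E D"
    and lo: "\<And>v. in_degree D v \<le> S v" and up: "\<And>v. S v \<le> 2 * in_degree D v"
  obtains w where "\<And>e. w e \<in> {1, 2 :: nat}" "\<And>v. in_weight D w v = S v"
proof -
  have "\<exists>B. B \<subseteq> in_neighbours D v \<and> card B = S v - in_degree D v" for v
    using up[of v] obtain_subset_with_card_n[of "S v - in_degree D v" "in_neighbours D v"]
    unfolding in_degree_def by (metis diff_le_mono diff_add_inverse mult_2)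
  then obtain B where B: "\<And>v. B v \<subseteq> in_neighbours D v" "\<And>v. card (B v) = S v - in_degree D v"
    by metis
  define w :: "'a set \<Rightarrow> nat" where "w e = (if \<exists>z v. e = {z, v} \<and> z \<in> B v then 2 else 1)" for e
  have "in_weight D w v = S v" for v
  proof -
    have w: "w {z, v} = 1 + (if z \<in> B v then 1 else 0)" if z: "z \<in> in_neighbours D v" for z
    proof -
      \<comment> \<open>A doubleton does not record its head; the orientation rules out that
        \<open>{z, v}\<close> was selected at its tail \<open>z\<close>.\<close>
      have "(v, z) \<notin> D" using z D unfolding in_neighbours_def is_orientation_def by blast
      then have "v \<notin> B z" using B(1)[of z] unfolding in_neighbours_def by blast
      then show ?thesis unfolding w_def by (auto simp: doubleton_eq_iff)
    qed
    have "in_weight D w v = (\<Sum>z\<in>in_neighbours D v. 1 + (if z \<in> B v then 1 else 0))"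
      unfolding in_weight_def by (intro sum.cong) (simp_all add: w)
    also have "\<dots> = in_degree D v + card (in_neighbours D v \<inter> B v)"
      using finite_in_neighbours[OF G D] 
      by (simp only: sum.distrib) (simp add: in_degree_def sum.If_cases)
    also have "in_neighbours D v \<inter> B v = B v" using B(1) by blast
    finally show ?thesis using B(2) lo by simp
  qed
  moreover have "w e \<in> {1, 2}" for e unfolding w_def by simp
  ultimately show ?thesis using that by blast
qed

lemma exists_semi_proper_orientation_one_two:
  assumes G: "simple_graph V E" and P: "proper_labelling E k D0 S0"
  obtains D w where "(D, w) \<in> semi_proper_orientations E" "\<And>e. w e \<in> {1, 2}"
    "\<And>v. in_weight D w v \<le> k"
proof -
  obtain D S where DS: "proper_labelling E k D S" and up: "\<And>v. S v \<le> 2 * in_degree D v"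
    using exists_balanced_proper_labelling[OF G P] by blast
  then obtain w where w: "\<And>e. w e \<in> {1, 2 :: nat}" "\<And>v. in_weight D w v = S v"
    using exists_weights_one_two[OF G, of D S] unfolding proper_labelling_def by metis
  have "w e > 0" for e using w(1)[of e] by auto
  then have "(D, w) \<in> semi_proper_orientations E"
    using DS unfolding semi_proper_orientations_def proper_labelling_def by (simp add: w(2))
  then show ?thesis using that w DS unfolding proper_labelling_def by simp
qed

text \<open>Each edge into a vertex contributes at least 1, and an empty sum is 0.\<close>

lemma proper_labelling_in_weight:
  assumes G: "simple_graph V E" and sp: "(D, w) \<in> semi_proper_orientations E"
  shows "proper_labelling E (max_in_weight V D w) D (in_weight D w)"
proof -
  have D: "is_orientation E D" and pos: "\<And>e. e \<in> E \<Longrightarrow> w e > 0"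
    and ne: "\<And>u v. {u, v} \<in> E \<Longrightarrow> in_weight D w u \<noteq> in_weight D w v"
    using sp unfolding semi_proper_orientations_def by auto
  note finN = finite_in_neighbours[OF G D]
  have "in_degree D v \<le> in_weight D w v" for v
  proof -
    have "1 \<le> w {z, v}" if "z \<in> in_neighbours D v" for z
      using that D pos[of "{z, v}"] unfolding in_neighbours_def is_orientation_def
      by (simp add: Suc_leI)
    then have "(\<Sum>z\<in>in_neighbours D v. 1) \<le> in_weight D w v"
      unfolding in_weight_def by (rule sum_mono)
    then show ?thesis unfolding in_degree_def by simp
  qed
  moreover have zero: "in_weight D w v = 0" if "in_degree D v = 0" for v
    using that finN[of v] unfolding in_degree_def in_weight_def by simp
  moreover have "in_weight D w v \<le> max_in_weight V D w" for v
  proof (cases "v \<in> V")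
    case True
    then show ?thesis
      using G unfolding max_in_weight_def simple_graph_def by (intro cSUP_upper) auto
  next
    case False
    \<comment> \<open>The supremum covers only \<open>V\<close>; elsewhere the in-weight is an empty
      sum.\<close>
    then have "in_neighbours D v = {}"
      using D simple_graph_edgeD(3)[OF G] unfolding in_neighbours_def is_orientation_def by blast
    then show ?thesis unfolding in_weight_def by simp
  qed
  ultimately show ?thesis using D ne unfolding proper_labelling_def by simp
qed

text \<open>Serves to show that semi-proper orientations exist. Arcs follow an injective numbering
  of \<open>V\<close>, which also separates positive labels.\<close>

lemma exists_proper_labelling:
  assumes G: "simple_graph V E"
  obtains k D S where "proper_labelling E k D S"
proof -
  have fin: "finite V" using G unfolding simple_graph_def by simp
  then obtain f :: "'a \<Rightarrow> nat" where inj: "inj_on f V"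
    using finite_imp_inj_to_nat_seg by blast
  define D where "D = {(u, v). {u, v} \<in> E \<and> f u < f v}"
  \<comment> \<open>Summand \<open>card V\<close> dominates the in-degree; adjacent vertices do not both have in-degree \<open>0\<close>.\<close>
  define S where "S v = (if in_degree D v = 0 then 0 else Suc (f v + card V))" for v
  have f_ne: "f u \<noteq> f v" if "{u, v} \<in> E" for u v
    using simple_graph_edgeD[OF G that] inj unfolding inj_on_def by blast
  have D: "is_orientation E D"
    using nat_neq_iff f_ne unfolding is_orientation_def D_def
    by (auto simp: insert_commute)
  have d: "in_degree D v \<le> card V" for v
    unfolding in_degree_def using card_mono[OF fin in_neighbours_subset[OF G D]] .
  have pos: "in_degree D v > 0" if "(u, v) \<in> D" for u v
    using that finite_in_neighbours[OF G D, of v] unfolding in_degree_def in_neighbours_def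
    by (auto simp: card_gt_0_iff)
  have ne: "S u \<noteq> S v" if "{u, v} \<in> E" for u v
  proof -
    have "(u, v) \<in> D \<or> (v, u) \<in> D" using D that unfolding is_orientation_def by blast
    then have "in_degree D u > 0 \<or> in_degree D v > 0" using pos by metis
    then show ?thesis using f_ne[OF that] unfolding S_def by auto
  qed
  \<comment> \<open>The sum of all labels is a crude choice of \<open>k\<close>.\<close>
  have "S v \<le> (\<Sum>x\<in>V. S x)" for v
  proof (cases "v \<in> V")
    case True
    then show ?thesis using fin by (intro member_le_sum) auto
  next
    case False
    then have "in_neighbours D v = {}"
      using simple_graph_edgeD(3)[OF G] unfolding in_neighbours_def D_def by blast
    then show ?thesis unfolding S_def in_degree_def by simp
  qed
  moreover have "in_degree D v \<le> S v" for v using d[of v] unfolding S_def by simp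
  ultimately have "proper_labelling E (\<Sum>x\<in>V. S x) D S"
    using D ne unfolding proper_labelling_def by (auto simp: S_def)
  then show ?thesis using that by blast
qed

theorem theorem1:
  fixes V :: "'a set" and E :: "'a set set"
  assumes "simple_graph V E"
  shows "\<exists>D w. optimal_semi_proper_orientation V E D w \<and> (\<forall>e\<in>E. w e \<in> {1, 2})"
proof -
  let ?A = "(\<lambda>(D, w). max_in_weight V D w) ` semi_proper_orientations E"
  \<comment> \<open>Nonemptiness makes the infimum an attained minimum.\<close>
  have "semi_proper_orientations E \<noteq> {}"
    using exists_proper_labelling[OF assms] exists_semi_proper_orientation_one_two[OF assms]
    by (metis empty_iff)
  then have "Inf ?A \<in> ?A" by (intro Inf_nat_def1) simp
  then obtain D0 w0 where sp0: "(D0, w0) \<in> semi_proper_orientations E"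
    and opt: "semi_proper_orientation_number V E = max_in_weight V D0 w0"
    unfolding semi_proper_orientation_number_def by auto
  obtain D w where sp: "(D, w) \<in> semi_proper_orientations E" and w: "\<And>e. w e \<in> {1, 2}"
    and le: "\<And>v. in_weight D w v \<le> max_in_weight V D0 w0"
    using exists_semi_proper_orientation_one_two[OF assms proper_labelling_in_weight[OF assms sp0]]
    by blast
  have "max_in_weight V D w \<le> max_in_weight V D0 w0"
  \<comment> \<open>\<open>cSUP_least\<close> requires a nonempty index set; for empty
    \<open>V\<close> both maxima are 0.\<close>
  proof (cases "V = {}")
    case True
    then show ?thesis unfolding max_in_weight_def by simp
  next
    case False
    then show ?thesis unfolding max_in_weight_def[of V D w] using le by (intro cSUP_least)
  qed
  moreover have "semi_proper_orientation_number V E \<le> max_in_weight V D w"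
    unfolding semi_proper_orientation_number_def using sp by (intro cInf_lower) force+
  ultimately have "optimal_semi_proper_orientation V E D w"
    using sp opt unfolding optimal_semi_proper_orientation_def by simp
  then show ?thesis using w by blast
qed

end
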